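(* The best-in-class error is achieved by some $h^*\in\mathcal{H}$ and the minimizability gap is null, $\mathcal{M}(\mathcal{H})=0$, if and only if there exists $h^*\in\mathcal{H}$ such that $$\mathbb{E}_y[\ell(h^*(x),y)\mid x]=\inf_{\alpha\in A}\mathbb{E}_y[\ell(\alpha,y)\mid x]\quad\text{a.s. over }\mathcal{X}.$$ If further $\alpha\mapsto\mathbb{E}_y[\ell(\alpha,y)\mid x]$ is injective and $\inf_{\alpha\in A}\mathbb{E}_y[\ell(\alpha,y)\mid x]=\mathbb{E}_y[\ell(\alpha^*(x),y)\mid x]$, then the condition is equivalent to $h^*(x)=\alpha^*(x)$ a.s. for $x\in\mathcal{X}$. Furthermore, the minimizability gap is bounded by $\epsilon$, $\mathcal{M}(\mathcal{H})\le\epsilon$, if and only if there exists $h^*\in\mathcal{H}$ such that $$\mathbb{E}_x\left[\mathbb{E}_y[\ell(h^*(x),y)\mid x]-\inf_{\alpha\in A}\mathbb{E}_y[\ell(\alpha,y)\mid x]\right]\le\epsilon.$$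
   Context: Binary classification: input space $\mathcal{X}$, labels $\{-1,+1\}$, $\mathcal{D}$ a distribution over $\mathcal{X}\times\{-1,+1\}$; $\mathcal{H}$ is a family of measurable functions $h\colon\mathcal{X}\to\mathbb{R}$. The surrogate loss is pointwise: its value for $h$ at $(x,y)$ is $\ell(h(x),y)$, with $\ell\colon\mathbb{R}\times\{-1,+1\}\to\mathbb{R}_+$ measurable. It is assumed that the set $A=\{h(x)\colon h\in\mathcal{H}\}$ of predictor values at $x$ does not depend on $x\in\mathcal{X}$. $\mathbb{E}_y[\,\cdot\mid x]$ is the expectation under the conditional distribution of the label given $x$, and $\mathbb{E}_x$ is the expectation over the marginal distribution of $x$. $\alpha^*(x)$ denotes the minimizer over $A$ of the conditional error $\alpha\mapsto\mathbb{E}_y[\ell(\alpha,y)\mid x]$. The best-in-class error is $\inf_{h\in\mathcal{H}}\mathbb{E}_{(x,y)\sim\mathcal{D}}[\ell(h(x),y)]$, and it is achieved by $h^*$ if $\mathbb{E}_{(x,y)\sim\mathcal{D}}[\ell(h^*(x),y)]$ equals it. The minimizability gap is $\mathcal{M}(\mathcal{H})=\inf_{h\in\mathcal{H}}\mathbb{E}_{(x,y)\sim\mathcal{D}}[\ell(h(x),y)]-\mathbb{E}_x\left[\inf_{h\in\mathcal{H}}\mathbb{E}_y[\ell(h(x),y)\mid x]\right]$.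
   Formalization: In the last part, the direction from M(H) ≤ ε to existence of h* is proved only if the best-in-class error is achieved or M(H) < ε (it is false otherwise); E_x[inf_h E_y[ℓ(h(x),y)|x]] is assumed finite so that the gap is well defined. *)

theory Defs
  imports "HOL-Probability.Probability"
begin

abbreviation labels :: "int set" where
  "labels \<equiv> {-1, 1}"

abbreviation label_space :: "int measure" where
  "label_space \<equiv> count_space labels"

definition marginal :: "'x measure \<Rightarrow> ('x \<times> int) measure \<Rightarrow> 'x measure" where
  "marginal MX D = distr D MX fst"

(* K is any version of the regular conditional distribution of the label given x.
   It is only determined up to a null set of the marginal; since there are two labels,
   a version always exists. *)
definition cond_label_dist ::
    "'x measure \<Rightarrow> ('x \<times> int) measure \<Rightarrow> ('x \<Rightarrow> int measure) \<Rightarrow> bool" where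
  "cond_label_dist MX D K \<longleftrightarrow>
     K \<in> measurable MX (prob_algebra label_space) \<and>
     (\<forall>B\<in>sets MX. \<forall>C\<in>sets label_space.
        emeasure D (B \<times> C) = (\<integral>\<^sup>+x\<in>B. emeasure (K x) C \<partial>marginal MX D))"

(* Expectation of a nonnegative function, possibly infinite. Only used for functions that are
   nonnegative on the space of M. The values are extended reals rather than ennreal so that
   differences and comparisons with negative bounds are not truncated at 0; the Bochner integral
   would assign 0 to a non-integrable loss. *)
definition nn_expectation :: "'a measure \<Rightarrow> ('a \<Rightarrow> real) \<Rightarrow> ereal" where
  "nn_expectation M f = enn2ereal (\<integral>\<^sup>+x. ennreal (f x) \<partial>M)"

definition gen_error :: "('x \<times> int) measure \<Rightarrow> (real \<Rightarrow> int \<Rightarrow> real) \<Rightarrow> ('x \<Rightarrow> real) \<Rightarrow> ereal" where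
  "gen_error D l h = nn_expectation D (\<lambda>(x, y). l (h x) y)"

definition best_in_class_error ::
    "('x \<times> int) measure \<Rightarrow> (real \<Rightarrow> int \<Rightarrow> real) \<Rightarrow> ('x \<Rightarrow> real) set \<Rightarrow> ereal" where
  "best_in_class_error D l H = (INF h\<in>H. gen_error D l h)"

definition best_in_class_achieved ::
    "('x \<times> int) measure \<Rightarrow> (real \<Rightarrow> int \<Rightarrow> real) \<Rightarrow> ('x \<Rightarrow> real) set \<Rightarrow> bool" where
  "best_in_class_achieved D l H \<longleftrightarrow> (\<exists>h\<in>H. gen_error D l h = best_in_class_error D l H)"

(* A Bochner integral suffices here: every function on the two-point label space is integrable. *)
definition cond_error ::
    "('x \<Rightarrow> int measure) \<Rightarrow> (real \<Rightarrow> int \<Rightarrow> real) \<Rightarrow> real \<Rightarrow> 'x \<Rightarrow> real" where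
  "cond_error K l a x = (\<integral>y. l a y \<partial>K x)"

definition expected_best_cond_error ::
    "'x measure \<Rightarrow> ('x \<times> int) measure \<Rightarrow> ('x \<Rightarrow> int measure) \<Rightarrow> (real \<Rightarrow> int \<Rightarrow> real) \<Rightarrow>
     ('x \<Rightarrow> real) set \<Rightarrow> ereal" where
  "expected_best_cond_error MX D K l H =
     nn_expectation (marginal MX D) (\<lambda>x. INF h\<in>H. cond_error K l (h x) x)"

(* Meaningful when the subtracted term is finite (in ereal, \<infinity> - \<infinity> = \<infinity>). *)
definition minimizability_gap ::
    "'x measure \<Rightarrow> ('x \<times> int) measure \<Rightarrow> ('x \<Rightarrow> int measure) \<Rightarrow> (real \<Rightarrow> int \<Rightarrow> real) \<Rightarrow>
     ('x \<Rightarrow> real) set \<Rightarrow> ereal" where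
  "minimizability_gap MX D K l H =
     best_in_class_error D l H - expected_best_cond_error MX D K l H"

end

theory Submission
  imports Defs
begin

text \<open>
  Write \<open>F h x\<close> for the conditional error of \<open>h\<close> at \<open>x\<close> and \<open>G x\<close> for its infimum over \<open>A\<close>.
  Disintegration along the label gives \<open>gen_error h = E F h\<close>. As \<open>E G\<close> is finite and \<open>G \<le> F h\<close>,
  subtracting \<open>E G\<close> shows that the minimizability gap is the infimum over \<open>h\<close> of \<open>E (F h - G)\<close>,
  and that the best-in-class error is attained exactly where this infimum is; a nonnegative function
  has expectation 0 iff it vanishes almost surely.

  Although \<open>A\<close> may be uncountable, \<open>G\<close> is measurable: it is an infimum of functions that are linear
  in the two label probabilities, hence an upper semicontinuous function of these.
\<close>

text \<open>An infimum lies below \<open>c\<close> exactly when one of its members does, so each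
  strict sublevel set is the preimage under \<open>g\<close> of a union of open sets. Openness
  survives unions of any size, hence \<open>A\<close> may be uncountable. The assumptions
  \<open>A \<noteq> {}\<close> and \<open>bdd\<close> ensure that the real-valued \<open>INF\<close>
  is a genuine infimum.\<close>

lemma borel_measurable_cINF_continuous:
  fixes f :: "'a \<Rightarrow> 'b::topological_space \<Rightarrow> real"
  assumes "A \<noteq> {}" and cont: "\<And>a. a \<in> A \<Longrightarrow> continuous_on UNIV (f a)"
    and g [measurable]: "g \<in> borel_measurable M"
    and bdd: "\<And>x. x \<in> space M \<Longrightarrow> bdd_below ((\<lambda>a. f a (g x)) ` A)"
  shows "(\<lambda>x. INF a\<in>A. f a (g x)) \<in> borel_measurable M"
  unfolding borel_measurable_iff_less
proof
  fix c
  let ?U = "\<Union>a\<in>A. {p. f a p < c}"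
  have "open ?U"
    using cont by (intro open_UN ballI open_Collect_less) auto
  then have "g -` ?U \<inter> space M \<in> sets M"
    by (intro measurable_sets[OF g]) auto
  moreover have "{x \<in> space M. (INF a\<in>A. f a (g x)) < c} = g -` ?U \<inter> space M"
    using cINF_less_iff[OF \<open>A \<noteq> {}\<close> bdd] by auto
  ultimately show "{x \<in> space M. (INF a\<in>A. f a (g x)) < c} \<in> sets M"
    by simp
qed

section \<open>The conditional label distribution as a probability kernel\<close>

lemma cond_label_dist_measurable:
  assumes "cond_label_dist MX D K" "C \<subseteq> labels"
  shows "(\<lambda>x. measure (K x) C) \<in> borel_measurable MX"
    and "(\<lambda>x. emeasure (K x) C) \<in> borel_measurable MX"
proof -
  have K: "K \<in> measurable MX (subprob_algebra label_space)"
    using assms by (auto simp: cond_label_dist_def intro: measurable_prob_algebraD)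
  show "(\<lambda>x. measure (K x) C) \<in> borel_measurable MX"
    using assms by (intro measurable_compose[OF K measurable_measure_subprob_algebra]) auto
  show "(\<lambda>x. emeasure (K x) C) \<in> borel_measurable MX"
    using assms by (intro measurable_compose[OF K measurable_emeasure_subprob_algebra]) auto
qed

lemma cond_label_dist_kernel:
  assumes "cond_label_dist MX D K" "x \<in> space MX"
  shows "prob_space (K x)" "sets (K x) = Pow labels" "space (K x) = labels"
proof -
  have "K x \<in> space (prob_algebra label_space)"
    using assms by (auto simp: cond_label_dist_def intro: measurable_space)
  then show "prob_space (K x)" and s: "sets (K x) = Pow labels"
    by (auto simp: space_prob_algebra)
  show "space (K x) = labels"
    using sets_eq_imp_space_eq[of "K x" label_space] s by simp
qed

text \<open>On the two labels the loss is a combination of two indicators. The resulting linearity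
  in the label probabilities yields nonnegativity and measurability of the conditional error, and
  continuity for the infimum over \<open>A\<close>.\<close>

lemma cond_error_eq:
  assumes "cond_label_dist MX D K" "x \<in> space MX"
  shows "cond_error K l a x = l a 1 * measure (K x) {1} + l a (-1) * measure (K x) {-1}"
proof -
  interpret prob_space "K x" by (rule cond_label_dist_kernel[OF assms])
  note [simp] = cond_label_dist_kernel(2,3)[OF assms]
  have "cond_error K l a x =
      (\<integral>y. l a 1 * indicator {1} y + l a (-1) * indicator {-1} y \<partial>K x)"
    unfolding cond_error_def by (rule Bochner_Integration.integral_cong) auto
  also have "\<dots> = l a 1 * measure (K x) {1} + l a (-1) * measure (K x) {-1}"
    by (subst Bochner_Integration.integral_add) (auto intro!: integrable_mult_right integrable_real_indicator simp: less_top[symmetric] simp del: integrable_mult_right_iff)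
  finally show ?thesis .
qed

section \<open>Disintegration of \<open>D\<close> along the label\<close>

lemma space_label_product:
  assumes "sets D = sets (MX \<Otimes>\<^sub>M label_space)"
  shows "space D = space MX \<times> labels"
  using sets_eq_imp_space_eq[OF assms] by (simp add: space_pair_measure)

lemma measurable_fst_label_product:
  assumes "sets D = sets (MX \<Otimes>\<^sub>M label_space)"
  shows "fst \<in> measurable D MX"
  using assms by (simp cong: measurable_cong_sets)

text \<open>The part of \<open>D\<close> with label \<open>c\<close>, projected to the inputs, has
  density \<open>emeasure (K x) {c}\<close> with respect to the marginal: on a measurable set
  \<open>B\<close> this is the defining property of \<open>K\<close> for the rectangle
  \<open>B \<times> {c}\<close>. Equality of measures then carries over to integrals of any
  nonnegative \<open>f\<close>.\<close>

lemma nn_integral_label_slice: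
  assumes D: "sets D = sets (MX \<Otimes>\<^sub>M label_space)"
    and K: "cond_label_dist MX D K" and c: "c \<in> labels"
    and f [measurable]: "f \<in> borel_measurable MX"
  shows "(\<integral>\<^sup>+z. f (fst z) * indicator (space MX \<times> {c}) z \<partial>D)
    = (\<integral>\<^sup>+x. f x * emeasure (K x) {c} \<partial>marginal MX D)"
proof -
  note [measurable] = measurable_fst_label_product[OF D]
  have [measurable]: "space MX \<times> {c} \<in> sets D"
    unfolding D using c by (intro pair_measureI) auto
  have [measurable_cong]: "sets (marginal MX D) = sets MX"
    by (simp add: marginal_def)
  have [measurable]: "(\<lambda>x. emeasure (K x) {c}) \<in> borel_measurable MX"
    using c by (intro cond_label_dist_measurable(2)[OF K]) auto
  let ?N = "distr (density D (indicator (space MX \<times> {c}))) MX fst"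
  have eq: "?N = density (marginal MX D) (\<lambda>x. emeasure (K x) {c})"
  proof (rule measure_eqI)
    show "sets ?N = sets (density (marginal MX D) (\<lambda>x. emeasure (K x) {c}))"
      by (simp add: marginal_def)
    fix B assume "B \<in> sets ?N"
    then have B [measurable]: "B \<in> sets MX" by simp
    have "emeasure ?N B = emeasure (density D (indicator (space MX \<times> {c}))) (fst -` B \<inter> space D)"
      by (subst emeasure_distr) auto
    also have "\<dots> = emeasure D ((space MX \<times> {c}) \<inter> (fst -` B \<inter> space D))"
      by (rule emeasure_restricted) measurable
    also have "(space MX \<times> {c}) \<inter> (fst -` B \<inter> space D) = B \<times> {c}"
      using c sets.sets_into_space[OF B] unfolding space_label_product[OF D] by auto
    also have "emeasure D (B \<times> {c}) = (\<integral>\<^sup>+x\<in>B. emeasure (K x) {c} \<partial>marginal MX D)"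
      using K B c unfolding cond_label_dist_def by auto
    also have "\<dots> = emeasure (density (marginal MX D) (\<lambda>x. emeasure (K x) {c})) B"
      by (subst emeasure_density) auto
    finally show "emeasure ?N B = emeasure (density (marginal MX D) (\<lambda>x. emeasure (K x) {c})) B" .
  qed
  have "(\<integral>\<^sup>+z. f (fst z) * indicator (space MX \<times> {c}) z \<partial>D) = (\<integral>\<^sup>+x. f x \<partial>?N)"
    by (subst nn_integral_distr) (auto simp: nn_integral_density mult.commute)
  also have "\<dots> = (\<integral>\<^sup>+x. f x * emeasure (K x) {c} \<partial>marginal MX D)"
    unfolding eq by (subst nn_integral_density) (auto simp: mult.commute)
  finally show ?thesis .
qed

text \<open>Law of total expectation: split the integral over \<open>D\<close> into its two label
  slices, disintegrate each, and recombine under the marginal. Both sides may be infinite.\<close>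

lemma gen_error_eq_cond_error:
  assumes D: "sets D = sets (MX \<Otimes>\<^sub>M label_space)"
    and K: "cond_label_dist MX D K"
    and h [measurable]: "h \<in> borel_measurable MX"
    and l: "(\<lambda>(a, y). l a y) \<in> borel_measurable (borel \<Otimes>\<^sub>M label_space)"
    and nonneg: "\<And>a y. y \<in> labels \<Longrightarrow> 0 \<le> l a y"
  shows "gen_error D l h = nn_expectation (marginal MX D) (\<lambda>x. cond_error K l (h x) x)"
proof -
  have lc: "(\<lambda>a. l a c) \<in> borel_measurable borel" if "c \<in> labels" for c
    using measurable_compose[OF measurable_Pair2'[of c label_space borel] l] that by simp
  have [measurable]: "(\<lambda>a. l a 1) \<in> borel_measurable borel" "(\<lambda>a. l a (-1)) \<in> borel_measurable borel"
    by (rule lc, simp)+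
  note [measurable] = measurable_fst_label_product[OF D]
  have [measurable]: "space MX \<times> {1} \<in> sets D" "space MX \<times> {-1} \<in> sets D"
    unfolding D by (intro pair_measureI; simp)+
  have [measurable_cong]: "sets (marginal MX D) = sets MX"
    by (simp add: marginal_def)
  have [measurable]: "(\<lambda>x. emeasure (K x) {1}) \<in> borel_measurable MX"
    "(\<lambda>x. emeasure (K x) {-1}) \<in> borel_measurable MX"
    by (intro cond_label_dist_measurable(2)[OF K]; simp)+
  \<comment> \<open>Each point of \<open>space D\<close> carries exactly one of the two labels, so
    exactly one indicator is 1 there.\<close>
  have "(\<integral>\<^sup>+z. ennreal (case z of (x, y) \<Rightarrow> l (h x) y) \<partial>D) =
      (\<integral>\<^sup>+z. ennreal (l (h (fst z)) 1) * indicator (space MX \<times> {1}) z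
        + ennreal (l (h (fst z)) (-1)) * indicator (space MX \<times> {-1}) z \<partial>D)"
    by (rule nn_integral_cong) (auto simp: space_label_product[OF D] split: split_indicator)
  also have "\<dots> = (\<integral>\<^sup>+z. ennreal (l (h (fst z)) 1) * indicator (space MX \<times> {1}) z \<partial>D)
        + (\<integral>\<^sup>+z. ennreal (l (h (fst z)) (-1)) * indicator (space MX \<times> {-1}) z \<partial>D)"
    by (rule nn_integral_add) measurable
  also have "\<dots> = (\<integral>\<^sup>+x. ennreal (l (h x) 1) * emeasure (K x) {1} \<partial>marginal MX D)
      + (\<integral>\<^sup>+x. ennreal (l (h x) (-1)) * emeasure (K x) {-1} \<partial>marginal MX D)"
    by (intro arg_cong2[where f="(+)"] nn_integral_label_slice[OF D K, where f="\<lambda>x. ennreal (l (h x) _)"])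
      auto
  also have "\<dots> = (\<integral>\<^sup>+x. ennreal (l (h x) 1) * emeasure (K x) {1}
      + ennreal (l (h x) (-1)) * emeasure (K x) {-1} \<partial>marginal MX D)"
    by (rule nn_integral_add[symmetric]) measurable
  also have "\<dots> = (\<integral>\<^sup>+x. ennreal (cond_error K l (h x) x) \<partial>marginal MX D)"
  proof (rule nn_integral_cong)
    fix x assume "x \<in> space (marginal MX D)"
    then have x: "x \<in> space MX" by (simp add: marginal_def)
    interpret prob_space "K x" by (rule cond_label_dist_kernel[OF K x])
    show "ennreal (l (h x) 1) * emeasure (K x) {1} + ennreal (l (h x) (-1)) * emeasure (K x) {-1}
      = ennreal (cond_error K l (h x) x)"
      by (simp add: cond_error_eq[OF K x] emeasure_eq_measure nonneg ennreal_mult ennreal_plus)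
  qed
  finally show ?thesis
    by (simp add: gen_error_def nn_expectation_def)
qed

text \<open>The equivalence for the bound \<epsilon> is stated under attainment of the best-in-class
  error: the gap is an infimum of expected excesses, and if it equals \<epsilon> without being
  attained, no predictor has excess at most \<epsilon>. In general a witness yields the bound, and a
  gap strictly below \<epsilon> yields a witness. Finiteness of
  \<open>expected_best_cond_error\<close> keeps the difference defining the gap meaningful.\<close>

theorem theorem17:
  fixes MX :: "'x measure"
    and D :: "('x \<times> int) measure"
    and K :: "'x \<Rightarrow> int measure"
    and H :: "('x \<Rightarrow> real) set"
    and l :: "real \<Rightarrow> int \<Rightarrow> real"
    and A :: "real set"
  assumes "prob_space D"
    and "sets D = sets (MX \<Otimes>\<^sub>M label_space)"
    and "cond_label_dist MX D K"
    and "H \<subseteq> borel_measurable MX"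
    and "(\<lambda>(a, y). l a y) \<in> borel_measurable (borel \<Otimes>\<^sub>M label_space)"
    and "\<And>a y. y \<in> labels \<Longrightarrow> 0 \<le> l a y"
    and "\<And>x. x \<in> space MX \<Longrightarrow> {h x | h. h \<in> H} = A"
    and "expected_best_cond_error MX D K l H < \<infinity>"
  shows
    "(best_in_class_achieved D l H \<and> minimizability_gap MX D K l H = 0 \<longleftrightarrow>
        (\<exists>h\<in>H. AE x in marginal MX D.
           cond_error K l (h x) x = (INF a\<in>A. cond_error K l a x)))
     \<and>
     (\<forall>\<alpha> :: 'x \<Rightarrow> real.
        (AE x in marginal MX D. inj_on (\<lambda>a. cond_error K l a x) A) \<and>
        (AE x in marginal MX D. \<alpha> x \<in> A \<and>
           (INF a\<in>A. cond_error K l a x) = cond_error K l (\<alpha> x) x) \<longrightarrow>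
        (\<forall>h\<in>H.
           (AE x in marginal MX D. cond_error K l (h x) x = (INF a\<in>A. cond_error K l a x))
           \<longleftrightarrow> (AE x in marginal MX D. h x = \<alpha> x)) \<and>
        (best_in_class_achieved D l H \<and> minimizability_gap MX D K l H = 0 \<longleftrightarrow>
           (\<exists>h\<in>H. AE x in marginal MX D. h x = \<alpha> x)))
     \<and>
     (\<forall>\<epsilon> :: real.
        (best_in_class_achieved D l H \<longrightarrow>
           (minimizability_gap MX D K l H \<le> ereal \<epsilon> \<longleftrightarrow>
              (\<exists>h\<in>H. nn_expectation (marginal MX D)
                 (\<lambda>x. cond_error K l (h x) x - (INF a\<in>A. cond_error K l a x)) \<le> ereal \<epsilon>))) \<and>
        ((\<exists>h\<in>H. nn_expectation (marginal MX D)
            (\<lambda>x. cond_error K l (h x) x - (INF a\<in>A. cond_error K l a x)) \<le> ereal \<epsilon>) \<longrightarrow>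
           minimizability_gap MX D K l H \<le> ereal \<epsilon>) \<and>
        (minimizability_gap MX D K l H < ereal \<epsilon> \<longrightarrow>
           (\<exists>h\<in>H. nn_expectation (marginal MX D)
              (\<lambda>x. cond_error K l (h x) x - (INF a\<in>A. cond_error K l a x)) \<le> ereal \<epsilon>)))"
proof -
  note D = assms(2) and K = assms(3) and nonneg = assms(6) and A = assms(7)
  define M where "M = marginal MX D"
  have sM [measurable_cong]: "sets M = sets MX" and spM: "space M = space MX"
    by (simp_all add: M_def marginal_def)
  define F where "F h x = cond_error K l (h x) x" for h x
  define G where "G x = (INF a\<in>A. cond_error K l a x)" for x
  \<comment> \<open>The expected excess of \<open>h\<close> over the pointwise optimum; all three
    claims reduce to statements about \<open>d\<close>. For \<open>h\<close> in \<open>H\<close> the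
    conversion by \<open>ennreal\<close> truncates nothing, because \<open>G x \<le> F h x\<close>
    on the space.\<close>
  define d where "d h = (\<integral>\<^sup>+x. ennreal (F h x - G x) \<partial>M)" for h
  define g where "g = (\<integral>\<^sup>+x. ennreal (G x) \<partial>M)"
  have hA: "h x \<in> A" if "h \<in> H" "x \<in> space MX" for h x
    using A[OF that(2)] that by auto
  have ce_nonneg: "0 \<le> cond_error K l a x" if "x \<in> space MX" for a x
    by (simp add: cond_error_eq[OF K that] nonneg)
  have bdd: "bdd_below ((\<lambda>a. cond_error K l a x) ` A)" if "x \<in> space MX" for x
    using ce_nonneg[OF that] by (rule bdd_belowI2)
  have FG: "0 \<le> G x" "G x \<le> F h x" if "h \<in> H" "x \<in> space MX" for h x
  proof -
    show "G x \<le> F h x"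
      unfolding F_def G_def by (rule cINF_lower[OF bdd hA]) fact+
    show "0 \<le> G x"
      unfolding G_def using hA[OF that] ce_nonneg[OF that(2)] by (intro cINF_greatest) auto
  qed
  have ebce: "expected_best_cond_error MX D K l H = enn2ereal g"
  proof -
    have "(INF h\<in>H. cond_error K l (h x) x) = G x" if "x \<in> space MX" for x
    proof -
      \<comment> \<open>At a fixed \<open>x\<close> only the value \<open>h x\<close> matters, and
        these values fill exactly \<open>A\<close>.\<close>
      have "(\<lambda>h. cond_error K l (h x) x) ` H = (\<lambda>a. cond_error K l a x) ` A"
        using A[OF that, symmetric] by auto
      then show ?thesis unfolding G_def by simp
    qed
    then show ?thesis
      unfolding expected_best_cond_error_def nn_expectation_def g_def M_def[symmetric]
      by (intro arg_cong[where f=enn2ereal] nn_integral_cong) (simp add: spM)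
  qed
  \<comment> \<open>A real \<open>r\<close> can be cancelled in extended real arithmetic.\<close>
  obtain r where r: "0 \<le> r" "g = ennreal r"
    using assms(8) unfolding ebce by (cases g) auto

  \<comment> \<open>Measurability of \<open>F h\<close> and \<open>G\<close>\<close>
  have meas_p [measurable]: "(\<lambda>x. measure (K x) {1}) \<in> borel_measurable MX"
    "(\<lambda>x. measure (K x) {-1}) \<in> borel_measurable MX"
    by (intro cond_label_dist_measurable(1)[OF K]; simp)+
  have lc: "(\<lambda>a. l a c) \<in> borel_measurable borel" if "c \<in> labels" for c
    using measurable_compose[OF measurable_Pair2'[of c label_space borel] assms(5)] that by simp
  have [measurable]: "(\<lambda>a. l a 1) \<in> borel_measurable borel" "(\<lambda>a. l a (-1)) \<in> borel_measurable borel"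
    by (rule lc, simp)+
  have F_meas [measurable]: "F h \<in> borel_measurable M" if "h \<in> H" for h
  proof -
    have [measurable]: "h \<in> borel_measurable MX" using assms(4) that by auto
    have "(\<lambda>x. l (h x) 1 * measure (K x) {1} + l (h x) (-1) * measure (K x) {-1}) \<in> borel_measurable M"
      by measurable
    then show ?thesis
      by (rule measurable_cong[THEN iffD1, rotated]) (simp add: F_def spM cond_error_eq[OF K])
  qed
  have G_meas [measurable]: "G \<in> borel_measurable M" if "H \<noteq> {}"
  proof (cases "space MX = {}")
    case True
    then show ?thesis by (auto simp: measurable_def spM)
  next
    case False
    \<comment> \<open>An element of \<open>A\<close> arises by evaluating a predictor at a point,
      which is why the empty space is split off.\<close>
    then have "A \<noteq> {}" using hA that by blast
    let ?f = "\<lambda>a p. l a 1 * fst p + l a (-1) * snd p :: real"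
    let ?p = "\<lambda>x. (measure (K x) {1}, measure (K x) {-1})"
    have "(\<lambda>x. INF a\<in>A. ?f a (?p x)) \<in> borel_measurable M"
    proof (rule borel_measurable_cINF_continuous)
      show "A \<noteq> {}" by fact
      show "continuous_on UNIV (?f a)" for a by (intro continuous_intros)
      show "?p \<in> borel_measurable M" by measurable
      show "bdd_below ((\<lambda>a. ?f a (?p x)) ` A)" if "x \<in> space M" for x
        using bdd[of x] that by (simp add: spM cond_error_eq[OF K])
    qed
    then show ?thesis
      by (rule measurable_cong[THEN iffD1, rotated]) (simp add: G_def spM cond_error_eq[OF K])
  qed

  \<comment> \<open>Error, gap and attainment in terms of the expected excess\<close>
  have err: "gen_error D l h = enn2ereal (d h) + ereal r" if "h \<in> H" for h
  proof -
    have [measurable]: "h \<in> borel_measurable MX" "F h \<in> borel_measurable M" "G \<in> borel_measurable M"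
      using that assms(4) F_meas G_meas by blast+
    have "gen_error D l h = enn2ereal (\<integral>\<^sup>+x. ennreal (F h x) \<partial>M)"
      using gen_error_eq_cond_error[OF D K _ assms(5) nonneg, of h]
      by (simp add: nn_expectation_def M_def F_def)
    also have "(\<integral>\<^sup>+x. ennreal (F h x) \<partial>M) = (\<integral>\<^sup>+x. ennreal (F h x - G x) + ennreal (G x) \<partial>M)"
      using FG[OF that] by (intro nn_integral_cong) (simp add: spM flip: ennreal_plus)
    also have "\<dots> = d h + g"
      unfolding d_def g_def by (rule nn_integral_add) measurable
    finally show ?thesis using r by (simp add: plus_ennreal.rep_eq enn2ereal_ennreal)
  qed
  have best: "best_in_class_error D l H = (INF h\<in>H. enn2ereal (d h)) + ereal r"
  \<comment> \<open>For empty \<open>H\<close> both infima are \<infinity>; moving \<open>r\<close>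
    out of the infimum is done for nonempty \<open>H\<close>.\<close>
  proof (cases "H = {}")
    case True
    then show ?thesis by (simp add: best_in_class_error_def top_ereal_def)
  next
    case False
    have "best_in_class_error D l H = (INF h\<in>H. enn2ereal (d h) + ereal r)"
      unfolding best_in_class_error_def using err by (intro INF_cong) auto
    also have "\<dots> = (INF h\<in>H. enn2ereal (d h)) + ereal r"
      using False r by (intro INF_ereal_add_left) auto
    finally show ?thesis .
  qed
  have gap: "minimizability_gap MX D K l H = (INF h\<in>H. enn2ereal (d h))"
    unfolding minimizability_gap_def best ebce
    using r by (cases "INF h\<in>H. enn2ereal (d h)") (auto simp: enn2ereal_ennreal)
  \<comment> \<open>The error and the excess differ by the finite constant \<open>r\<close>, so they
    have the same minimizers.\<close>
  have ach: "best_in_class_achieved D l H \<longleftrightarrow> (\<exists>h\<in>H. enn2ereal (d h) = (INF h\<in>H. enn2ereal (d h)))"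
    unfolding best_in_class_achieved_def best
    by (intro bex_cong refl) (simp add: err ereal_add_cancel_right)
  have d0: "d h = 0 \<longleftrightarrow> (AE x in M. F h x = G x)" if "h \<in> H" for h
  proof -
    have [measurable]: "F h \<in> borel_measurable M" "G \<in> borel_measurable M"
      using that F_meas G_meas by blast+
    have "d h = 0 \<longleftrightarrow> (AE x in M. ennreal (F h x - G x) = 0)"
      unfolding d_def by (rule nn_integral_0_iff_AE) measurable
    also have "\<dots> \<longleftrightarrow> (AE x in M. F h x = G x)"
      using FG[OF that] by (intro AE_cong) (fastforce simp: spM ennreal_eq_0_iff intro: antisym)
    finally show ?thesis .
  qed

  \<comment> \<open>Derivation of the three claims\<close>
  have zero: "best_in_class_achieved D l H \<and> minimizability_gap MX D K l H = 0 \<longleftrightarrow>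
      (\<exists>h\<in>H. AE x in M. F h x = G x)" (is "?L \<longleftrightarrow> ?R")
  proof
    assume ?L
    then obtain h where "h \<in> H" "enn2ereal (d h) = 0"
      unfolding ach gap by auto
    then show ?R using d0 by (metis enn2ereal_inject zero_ennreal.rep_eq)
  next
    assume ?R
    then obtain h where h: "h \<in> H" "d h = 0" using d0 by auto
    have "(INF h\<in>H. enn2ereal (d h)) = 0"
      using h INF_lower[OF h(1), of "\<lambda>h. enn2ereal (d h)"]
      by (intro antisym INF_greatest) (auto simp: zero_ennreal.rep_eq)
    then show ?L unfolding ach gap using h by (auto simp: zero_ennreal.rep_eq intro!: bexI[of _ h])
  qed
  have inj: "(AE x in M. F h x = G x) \<longleftrightarrow> (AE x in M. h x = \<alpha> x)"
    if "AE x in M. inj_on (\<lambda>a. cond_error K l a x) A"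
      "AE x in M. \<alpha> x \<in> A \<and> G x = cond_error K l (\<alpha> x) x" "h \<in> H" for \<alpha> h
  proof -
    \<comment> \<open>Almost surely \<open>G x\<close> is the conditional error at
      \<open>\<alpha> x\<close>, and both \<open>h x\<close> and \<open>\<alpha> x\<close> lie in
      \<open>A\<close>, where injectivity applies; \<open>AE_space\<close> supplies the membership
      of \<open>x\<close> that puts \<open>h x\<close> in \<open>A\<close>.\<close>
    have "AE x in M. F h x = G x \<longleftrightarrow> h x = \<alpha> x"
      using that(1,2) AE_space[of M]
      by eventually_elim (auto simp: F_def spM dest: inj_onD intro: hA[OF that(3)])
    then show ?thesis by (rule eventually_subst)
  qed
  have minimizer: "\<forall>\<alpha>. (AE x in M. inj_on (\<lambda>a. cond_error K l a x) A) \<and>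
        (AE x in M. \<alpha> x \<in> A \<and> G x = cond_error K l (\<alpha> x) x) \<longrightarrow>
        (\<forall>h\<in>H. (AE x in M. F h x = G x) \<longleftrightarrow> (AE x in M. h x = \<alpha> x)) \<and>
        (best_in_class_achieved D l H \<and> minimizability_gap MX D K l H = 0 \<longleftrightarrow>
           (\<exists>h\<in>H. AE x in M. h x = \<alpha> x))"
    unfolding zero using inj by (intro allI impI conjI ballI bex_cong refl) blast+
  have le: "minimizability_gap MX D K l H \<le> ereal \<epsilon>"
    if "\<exists>h\<in>H. enn2ereal (d h) \<le> ereal \<epsilon>" for \<epsilon>
    using that unfolding gap by (auto intro: INF_lower2)
  have less: "\<exists>h\<in>H. enn2ereal (d h) \<le> ereal \<epsilon>"
    if "minimizability_gap MX D K l H < ereal \<epsilon>" for \<epsilon>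
    using that unfolding gap INF_less_iff by (auto intro: less_imp_le)
  \<comment> \<open>The predictor attaining the infimum has excess equal to the gap, so a non-strict
    bound suffices here.\<close>
  have attained: "\<exists>h\<in>H. enn2ereal (d h) \<le> ereal \<epsilon>"
    if "best_in_class_achieved D l H" "minimizability_gap MX D K l H \<le> ereal \<epsilon>" for \<epsilon>
    using that unfolding ach gap by metis
  have bound: "\<forall>\<epsilon>::real.
      (best_in_class_achieved D l H \<longrightarrow>
        (minimizability_gap MX D K l H \<le> ereal \<epsilon> \<longleftrightarrow> (\<exists>h\<in>H. enn2ereal (d h) \<le> ereal \<epsilon>))) \<and>
      ((\<exists>h\<in>H. enn2ereal (d h) \<le> ereal \<epsilon>) \<longrightarrow> minimizability_gap MX D K l H \<le> ereal \<epsilon>) \<and>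
      (minimizability_gap MX D K l H < ereal \<epsilon> \<longrightarrow> (\<exists>h\<in>H. enn2ereal (d h) \<le> ereal \<epsilon>))"
    using le less attained by blast
  show ?thesis
    using zero minimizer bound unfolding d_def F_def G_def M_def nn_expectation_def
    by (intro conjI)
qed

end
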